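(* Let $m,n\in\mathbb N$, $1\le\gamma<\infty$, and $\varepsilon,b\in(0,1)$. Then for any $N\ge m+n$ and any random vector $(a_j)_{j=0}^N$ with independent coordinates, $\mathbb E|a_j|\le\gamma$ and $\mathcal L(a_j,\varepsilon)\le b$ for all $j$, the numerator $P_{mn}$ of the $[m,n]$-Padé approximant of $f_N(z)=\sum_{j=0}^N a_jz^j$ satisfies $$\mathbb P\left(\log L(P_{mn})>\log m+2n\log\left(\frac{4\gamma}{b\varepsilon}\right)\right)\le 5nb.$$
   Context: The coefficients are random variables $a_j:(\Omega,\mathbb P)\to\mathbb C$. Lévy concentration function: for a random variable $\xi$ and $\delta>0$, $\mathcal L(\xi,\delta)=\sup_{t\in\mathbb R}\mathbb P(|\xi-t|<\delta)$. Padé approximant: for $f(z)=\sum_j a_jz^j$, the $[m,n]$-Padé approximant is the (unique) rational function $P_{mn}/Q_{mn}$, where $P_{mn}$ and $Q_{mn}$ are polynomials of degree at most $m$ and $n$ respectively, $Q_{mn}\not\equiv0$, and $f(z)Q_{mn}(z)-P_{mn}(z)=\sum_{j\ge m+n+1}c_jz^j$ for some $c_j$. Set $a_l=0$ for $l<0$ and let $A_m^{(k)}$ be the $k\times k$ Toeplitz matrix with $(i,j)$ entry $a_{m+i-j}$, $1\le i,j\le k$. When these Toeplitz determinants do not vanish, $P_{mn}$ and $Q_{mn}$ are determined up to a common constant factor and can be written with $Q_{mn}(0)=1$ and $P_{mn}(z)=a_0+\dots+\frac{\det A_m^{(n+1)}}{\det A_m^{(n)}}z^m$. Erdős–Turán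 ratio: for a polynomial $P(z)=\alpha_0+\alpha_1z+\dots+\alpha_dz^d$ with $\alpha_0\alpha_d\neq0$, $L(P)=\dfrac{|\alpha_0|+|\alpha_1|+\dots+|\alpha_d|}{\sqrt{|\alpha_0|\,|\alpha_d|}}$.
   Formalization: The supremum in the Lévy concentration function of the complex coefficients is taken over all complex centres t instead of real t only; with real t the claim fails (m=n=1, a_0=a_1=i, a_2=i(1-η), η small), and for real-valued coefficients both agree. *)

theory Defs
  imports
    "HOL-Probability.Probability"
    "HOL-Computational_Algebra.Computational_Algebra"
begin

text \<open>
  The centre \<open>t\<close> ranges over the value space of the random variable: over the reals for real-valued
  \<open>X\<close>, over the complex plane for complex-valued \<open>X\<close>. For a real-valued variable regarded as a complex
  one both readings give the same number.
\<close>

definition levy_concentration ::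
    "'w measure \<Rightarrow> ('w \<Rightarrow> 'b :: real_normed_vector) \<Rightarrow> real \<Rightarrow> real" where
  "levy_concentration M X \<delta> = (SUP t. measure M {\<omega> \<in> space M. norm (X \<omega> - t) < \<delta>})"

definition pade_pair :: "'a :: field fps \<Rightarrow> nat \<Rightarrow> nat \<Rightarrow> 'a poly \<Rightarrow> 'a poly \<Rightarrow> bool" where
  "pade_pair f m n P Q \<longleftrightarrow>
     degree P \<le> m \<and> degree Q \<le> n \<and> Q \<noteq> 0 \<and>
     (\<exists>c. f * fps_of_poly Q - fps_of_poly P = fps_X ^ (m + n + 1) * c)"

text \<open>
  Only the quotient \<open>P / Q\<close> is unique. The pair itself is determined up to a constant factor when the
  relevant Toeplitz determinants do not vanish, but in general only up to common polynomial factors;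
  hence being a numerator is a predicate and not a function.
\<close>

definition pade_numerator :: "'a :: field fps \<Rightarrow> nat \<Rightarrow> nat \<Rightarrow> 'a poly \<Rightarrow> bool" where
  "pade_numerator f m n P \<longleftrightarrow> (\<exists>Q. pade_pair f m n P Q)"

text \<open>
  Meaningful only if \<open>coeff P 0 * lead_coeff P \<noteq> 0\<close>; otherwise division by zero makes the value \<open>0\<close>.
\<close>

definition erdos_turan_ratio :: "complex poly \<Rightarrow> real" where
  "erdos_turan_ratio P =
     (\<Sum>i\<le>degree P. cmod (coeff P i)) / sqrt (cmod (coeff P 0) * cmod (lead_coeff P))"

end

theory Submission imports Defs "Jordan_Normal_Form.Determinant" begin

text \<open>
  Normalise \<open>Q\<close> so that its coefficients are the cofactors of the first row of \<open>A_m^(n+1)\<close>. Then the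
  extreme coefficients of \<open>P\<close> are \<open>a_0 det A_m^(n)\<close> and \<open>det A_m^(n+1)\<close>. The corner entry \<open>a_(m+k-1)\<close> of
  \<open>A_m^(k)\<close> occurs only once, with cofactor \<open>\<plusminus> det A_(m-1)^(k-1)\<close>, so by independence each passage from
  \<open>k - 1\<close> to \<open>k\<close> costs the determinant at most a factor \<open>\<epsilon>\<close>, outside an event of probability \<open>b\<close>.
  Conversely, the coefficients of \<open>Q\<close> have total modulus at most \<open>S^n\<close>, where \<open>S\<close> is the sum of the moduli
  of the \<open>2n\<close> entries involved, and Markov's inequality bounds \<open>S\<close> by \<open>4n\<gamma>/b\<close>. The factor \<open>n^n\<close> produced
  in this way is harmless: the claim is trivial unless \<open>5nb < 1\<close>, and then \<open>n^n\<close> is absorbed by the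
  remaining powers of \<open>1/b\<close>.
\<close>

subsection \<open>Pade pairs and Toeplitz determinants\<close>

text \<open>The guard encodes a_l = 0 for l < 0, where truncated subtraction would give
  \<open>c 0\<close>. Rows are counted by the absolute index \<open>i\<close>, so the same entries
  describe the rows of \<open>A_m^(k)\<close> and the coefficients of the product f Q.\<close>

definition toeplitz_entry :: "(nat \<Rightarrow> 'a::zero) \<Rightarrow> nat \<Rightarrow> nat \<Rightarrow> 'a" where
  "toeplitz_entry c i j = (if j \<le> i then c (i - j) else 0)"

definition toeplitz :: "(nat \<Rightarrow> 'a::zero) \<Rightarrow> nat \<Rightarrow> nat \<Rightarrow> 'a Matrix.mat" where
  "toeplitz c m k = Matrix.mat k k (\<lambda>(i, j). toeplitz_entry c (m + i) j)"

definition toeplitz_det :: "(nat \<Rightarrow> 'a::comm_ring_1) \<Rightarrow> nat \<Rightarrow> nat \<Rightarrow> 'a" where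
  "toeplitz_det c m k = Determinant.det (toeplitz c m k)"

text \<open>The argument \<open>n\<close> is the degree of the denominator; the matrix has size
  \<open>n + 1\<close>.\<close>

definition toeplitz_cofactor :: "(nat \<Rightarrow> 'a::comm_ring_1) \<Rightarrow> nat \<Rightarrow> nat \<Rightarrow> nat \<Rightarrow> 'a" where
  "toeplitz_cofactor c m n j = cofactor (toeplitz c m (Suc n)) 0 j"

lemma toeplitz_carrier [simp]: "toeplitz c m k \<in> carrier_mat k k"
  by (simp add: toeplitz_def)

lemma toeplitz_index [simp]:
  "i < k \<Longrightarrow> j < k \<Longrightarrow> toeplitz c m k $$ (i, j) = toeplitz_entry c (m + i) j"
  by (simp add: toeplitz_def)

text \<open>The largest index that occurs is m + k - 1, in the bottom left corner.\<close>

lemma toeplitz_cong: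
  assumes "\<And>l. l < m + k \<Longrightarrow> c l = d l"
  shows "toeplitz c m k = toeplitz d m k"
  using assms by (auto simp: toeplitz_def toeplitz_entry_def intro!: eq_matI)

lemma toeplitz_cofactor_0: "toeplitz_cofactor c m n 0 = toeplitz_det c m n"
proof -
  have "mat_delete (toeplitz c m (Suc n)) 0 0 = toeplitz c m n"
    by (rule eq_matI) (auto simp: mat_delete_def toeplitz_def toeplitz_entry_def)
  then show ?thesis by (simp add: toeplitz_cofactor_def cofactor_def toeplitz_det_def)
qed

text \<open>Dropping column 0 lowers every index by one, and dropping the last row changes none. For
  positive \<open>m\<close> the shift is absorbed by \<open>m - 1\<close> without
  truncation.\<close>

lemma mat_delete_toeplitz_corner:
  assumes "m > 0"
  shows "mat_delete (toeplitz c m (Suc k)) k 0 = toeplitz c (m - 1) k"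
  using assms by (intro eq_matI) (auto simp: mat_delete_def toeplitz_def toeplitz_entry_def)

text \<open>This is column 0 of T adj(T) = det(T) I. Read as a product of series, it says that f Q
  has coefficient \<open>det A_m^(n+1)\<close> at degree m and zeros at degrees m + 1 to m +
  n.\<close>

lemma toeplitz_mult_cofactor:
  assumes "i \<le> n"
  shows "(\<Sum>j\<le>n. toeplitz_entry c (m + i) j * toeplitz_cofactor c m n j)
           = (if i = 0 then toeplitz_det c m (Suc n) else 0)"
proof -
  let ?T = "toeplitz c m (Suc n)"
  have T: "?T \<in> carrier_mat (Suc n) (Suc n)" by simp
  have "(?T * adj_mat ?T) $$ (i, 0) = (Determinant.det ?T \<cdot>\<^sub>m 1\<^sub>m (Suc n)) $$ (i, 0)"
    by (simp only: adj_mat(2)[OF T])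
  also have "\<dots> = (if i = 0 then toeplitz_det c m (Suc n) else 0)"
    using assms by (simp add: toeplitz_det_def)
  also have "(?T * adj_mat ?T) $$ (i, 0)
               = (\<Sum>j<Suc n. toeplitz_entry c (m + i) j * toeplitz_cofactor c m n j)"
    using assms carrier_matD[OF T]
    by (simp add: adj_mat_def scalar_prod_def toeplitz_cofactor_def atLeast0LessThan del: sum.lessThan_Suc sum.op_ivl_Suc)
  finally show ?thesis by (simp add: lessThan_Suc_atMost)
qed

section \<open>Pade pairs as solutions of linear equations\<close>

lemma fps_mult_poly_nth:
  fixes f :: "'a::comm_ring_1 fps"
  assumes "degree Q \<le> n"
  shows "fps_nth (f * fps_of_poly Q) i = (\<Sum>j\<le>n. toeplitz_entry (fps_nth f) i j * coeff Q j)"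
proof -
  have "fps_nth (f * fps_of_poly Q) i = (\<Sum>j=0..i. fps_nth f (i - j) * coeff Q j)"
    by (subst mult.commute, subst fps_mult_nth) (simp add: mult.commute)
  also have "\<dots> = (\<Sum>j\<in>{0..i} \<union> {..n}. toeplitz_entry (fps_nth f) i j * coeff Q j)"
    using assms by (intro sum.mono_neutral_cong_left) (auto simp: toeplitz_entry_def coeff_eq_0)
  also have "\<dots> = (\<Sum>j\<le>n. toeplitz_entry (fps_nth f) i j * coeff Q j)"
    using assms by (intro sum.mono_neutral_cong_right) (auto simp: coeff_eq_0 intro: ccontr)
  finally show ?thesis .
qed

lemma pade_pair_iff:
  fixes f :: "'a::field fps"
  shows "pade_pair f m n P Q \<longleftrightarrow> degree P \<le> m \<and> degree Q \<le> n \<and> Q \<noteq> 0 \<and>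
     (\<forall>i\<le>m + n. coeff P i = (\<Sum>j\<le>n. toeplitz_entry (fps_nth f) i j * coeff Q j))"
proof -
  have dvd: "(\<exists>c. g = fps_X ^ k * c) \<longleftrightarrow> (\<forall>i<k. fps_nth g i = 0)" for g :: "'a fps" and k
  proof
    assume "\<forall>i<k. fps_nth g i = 0"
    then have "g = fps_X ^ k * fps_shift k g"
      by (intro fps_ext) (auto simp: fps_X_power_mult_nth)
    then show "\<exists>c. g = fps_X ^ k * c" ..
  qed (auto simp: fps_X_power_mult_nth)
  show ?thesis
    unfolding pade_pair_def dvd
    by (auto simp: fps_mult_poly_nth less_Suc_eq_le)
qed

text \<open>The normalisation Q(0) = \<open>det A_m^(n)\<close> in place of Q(0) = 1 avoids
  division: all coefficients are polynomials in the \<open>c j\<close>, defined and measurable even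
  where the determinant vanishes.\<close>

definition pade_denom_poly :: "(nat \<Rightarrow> 'a::comm_ring_1) \<Rightarrow> nat \<Rightarrow> nat \<Rightarrow> 'a poly" where
  "pade_denom_poly c m n = (\<Sum>j\<le>n. monom (toeplitz_cofactor c m n j) j)"

definition pade_num_poly :: "(nat \<Rightarrow> 'a::comm_ring_1) \<Rightarrow> nat \<Rightarrow> nat \<Rightarrow> 'a poly" where
  "pade_num_poly c m n =
     (\<Sum>i\<le>m. monom (\<Sum>j\<le>n. toeplitz_entry c i j * toeplitz_cofactor c m n j) i)"

lemma coeff_pade_denom_poly:
  "coeff (pade_denom_poly c m n) j = (if j \<le> n then toeplitz_cofactor c m n j else 0)"
  by (simp add: pade_denom_poly_def coeff_sum)

lemma coeff_pade_num_poly: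
  "coeff (pade_num_poly c m n) i
     = (if i \<le> m then \<Sum>j\<le>n. toeplitz_entry c i j * toeplitz_cofactor c m n j else 0)"
  by (simp add: pade_num_poly_def coeff_sum)

lemma degree_pade_num_poly: "degree (pade_num_poly c m n) \<le> m"
  by (intro degree_le) (simp add: coeff_pade_num_poly)

lemma coeff_pade_num_poly_0: "coeff (pade_num_poly c m n) 0 = c 0 * toeplitz_det c m n"
proof -
  have "coeff (pade_num_poly c m n) 0 = (\<Sum>j\<in>{0}. toeplitz_entry c 0 j * toeplitz_cofactor c m n j)"
    unfolding coeff_pade_num_poly if_P[OF le0]
    by (intro sum.mono_neutral_cong_right) (auto simp: toeplitz_entry_def)
  then show ?thesis by (simp add: toeplitz_entry_def toeplitz_cofactor_0)
qed

lemma coeff_pade_num_poly_top: "coeff (pade_num_poly c m n) m = toeplitz_det c m (Suc n)"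
  using toeplitz_mult_cofactor[of 0 n c m] by (simp add: coeff_pade_num_poly)

lemma pade_pair_pade_polys:
  fixes f :: "'a::field fps"
  assumes "toeplitz_det (fps_nth f) m n \<noteq> 0"
  shows "pade_pair f m n (pade_num_poly (fps_nth f) m n) (pade_denom_poly (fps_nth f) m n)"
proof -
  let ?Q = "pade_denom_poly (fps_nth f) m n"
  have "coeff ?Q 0 \<noteq> 0" using assms by (simp add: coeff_pade_denom_poly toeplitz_cofactor_0)
  then have "?Q \<noteq> 0" by auto
  moreover have "degree ?Q \<le> n"
    by (intro degree_le) (simp add: coeff_pade_denom_poly)
  moreover have "coeff (pade_num_poly (fps_nth f) m n) i
      = (\<Sum>j\<le>n. toeplitz_entry (fps_nth f) i j * coeff ?Q j)" if "i \<le> m + n" for i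
    using that toeplitz_mult_cofactor[of "i - m" n "fps_nth f" m]
    by (cases "i \<le> m") (auto simp: coeff_pade_num_poly coeff_pade_denom_poly)
  ultimately show ?thesis
    by (simp add: pade_pair_iff degree_pade_num_poly)
qed

text \<open>Kernel vectors are stated as plain functions so that they can be read as coefficients of
  denominators.\<close>

lemma toeplitz_kernel_iff:
  fixes c :: "nat \<Rightarrow> 'a::field"
  shows "toeplitz_det c m n = 0 \<longleftrightarrow>
    (\<exists>v. (\<exists>j<n. v j \<noteq> 0) \<and> (\<forall>i<n. (\<Sum>j<n. toeplitz_entry c (m + i) j * v j) = 0))"
proof -
  have T: "toeplitz c m n \<in> carrier_mat n n" by simp
  have mv: "toeplitz c m n *\<^sub>v v = 0\<^sub>v n \<longleftrightarrow>
      (\<forall>i<n. (\<Sum>j<n. toeplitz_entry c (m + i) j * vec_index v j) = 0)"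
    if "v \<in> carrier_vec n" for v
    using that carrier_matD[OF T]
    by (simp add: Matrix.vec_eq_iff scalar_prod_def atLeast0LessThan)
  show ?thesis
    unfolding toeplitz_det_def det_0_iff_vec_prod_zero_field[OF T]
  proof safe
    fix v assume v: "v \<in> carrier_vec n" "v \<noteq> 0\<^sub>v n" "toeplitz c m n *\<^sub>v v = 0\<^sub>v n"
    then show "\<exists>v. (\<exists>j<n. v j \<noteq> 0) \<and> (\<forall>i<n. (\<Sum>j<n. toeplitz_entry c (m + i) j * v j) = 0)"
      using mv[of v] by (intro exI[of _ "vec_index v"]) (auto simp: Matrix.vec_eq_iff)
  next
    fix v j assume "\<forall>i<n. (\<Sum>j<n. toeplitz_entry c (m + i) j * v j) = 0" "j < n" "v j \<noteq> 0"
    then show "\<exists>v. v \<in> carrier_vec n \<and> v \<noteq> 0\<^sub>v n \<and> toeplitz c m n *\<^sub>v v = 0\<^sub>v n"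
      using mv[of "Matrix.vec n v"] by (intro exI[of _ "Matrix.vec n v"]) (auto simp: Matrix.vec_eq_iff)
  qed
qed

text \<open>A kernel vector of the Toeplitz matrix, shifted by one place, is a denominator vanishing at \<open>0\<close>.\<close>

lemma pade_numerator_degenerate:
  fixes f :: "'a::field fps"
  assumes "toeplitz_det (fps_nth f) m n = 0"
  shows "\<exists>P. pade_numerator f m n P \<and> coeff P 0 = 0"
proof -
  let ?t = "toeplitz_entry (fps_nth f)"
  obtain v k where v: "k < n" "v k \<noteq> 0" "\<And>i. i < n \<Longrightarrow> (\<Sum>j<n. ?t (m + i) j * v j) = 0"
    using assms unfolding toeplitz_kernel_iff by blast
  define Q where "Q = pCons 0 (\<Sum>j<n. monom (v j) j)"
  have cQ: "coeff Q j = (if j = 0 \<or> j > n then 0 else v (j - 1))" for j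
    by (auto simp: Q_def coeff_pCons coeff_sum split: nat.splits)
  have shift: "(\<Sum>j\<le>n. ?t i j * coeff Q j) = (\<Sum>j<n. ?t i (Suc j) * v j)" for i
  proof -
    have "(\<Sum>j\<le>n. ?t i j * coeff Q j) = (\<Sum>j<Suc n. ?t i j * coeff Q j)"
      by (simp only: lessThan_Suc_atMost)
    also have "\<dots> = (\<Sum>j<n. ?t i (Suc j) * v j)"
      by (subst sum.lessThan_Suc_shift) (auto simp: cQ intro!: sum.cong)
    finally show ?thesis .
  qed
  define P where "P = (\<Sum>i\<le>m. monom (\<Sum>j\<le>n. ?t i j * coeff Q j) i)"
  have cP: "coeff P i = (if i \<le> m then \<Sum>j\<le>n. ?t i j * coeff Q j else 0)" for i
    by (simp add: P_def coeff_sum)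
  have "coeff Q (Suc k) \<noteq> 0" using v(1,2) by (simp add: cQ)
  then have "Q \<noteq> 0" by auto
  moreover have "degree Q \<le> n" by (intro degree_le) (simp add: cQ)
  moreover have "degree P \<le> m" by (intro degree_le) (simp add: cP)
  moreover have "coeff P i = (\<Sum>j\<le>n. ?t i j * coeff Q j)" if "i \<le> m + n" for i
  proof (cases "i \<le> m")
    case False
    \<comment> \<open>Entries depend only on the difference of the indices, so the conditions at
      degrees m + 1 to m + n become rows 0 to n - 1 of \<open>A_m^(n)\<close>.\<close>
    have "(\<Sum>j<n. ?t i (Suc j) * v j) = (\<Sum>j<n. ?t (m + (i - m - 1)) j * v j)"
      using False by (intro sum.cong) (auto simp: toeplitz_entry_def)
    then show ?thesis using v(3)[of "i - m - 1"] False that by (simp add: cP shift)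
  qed (simp add: cP)
  ultimately have "pade_pair f m n P Q" by (simp add: pade_pair_iff)
  moreover have "coeff P 0 = 0" by (auto simp: cP cQ toeplitz_entry_def intro!: sum.neutral)
  ultimately show ?thesis unfolding pade_numerator_def by blast
qed

text \<open>Subtracting a multiple of the explicit pair makes the constant term of the denominator
  vanish. The remaining coefficients, shifted by one place, lie in the kernel of the invertible
  matrix \<open>A_m^(n)\<close> and hence are zero.\<close>

lemma pade_numerator_unique:
  fixes f :: "'a::field fps"
  assumes D: "toeplitz_det (fps_nth f) m n \<noteq> 0" and P: "pade_numerator f m n P"
  shows "\<exists>s. s \<noteq> 0 \<and> P = Polynomial.smult s (pade_num_poly (fps_nth f) m n)"
proof -
  let ?t = "toeplitz_entry (fps_nth f)"
  let ?P = "pade_num_poly (fps_nth f) m n" and ?Q = "pade_denom_poly (fps_nth f) m n"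
  obtain Q where PQ: "pade_pair f m n P Q" using P by (auto simp: pade_numerator_def)
  note pq = PQ[unfolded pade_pair_iff]
  note pq0 = pade_pair_pade_polys[OF D, unfolded pade_pair_iff]
  have q0: "coeff ?Q 0 \<noteq> 0" using D by (simp add: coeff_pade_denom_poly toeplitz_cofactor_0)
  define s where "s = coeff Q 0 / coeff ?Q 0"
  define w where "w = (\<lambda>j. coeff Q j - s * coeff ?Q j)"
  have w0: "w 0 = 0" using q0 by (simp add: w_def s_def)
  have tw: "(\<Sum>j\<le>n. ?t i j * w j) = coeff P i - s * coeff ?P i" if "i \<le> m + n" for i
    using pq pq0 that by (simp add: w_def sum_subtractf sum_distrib_left algebra_simps)
  have w: "w (Suc j) = 0" if "j < n" for j
  proof (rule ccontr)
    assume "w (Suc j) \<noteq> 0"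
    moreover have "(\<Sum>j<n. ?t (m + i) j * w (Suc j)) = 0" if "i < n" for i
    proof -
      have "(\<Sum>j<n. ?t (m + i) j * w (Suc j)) = (\<Sum>j<n. ?t (Suc (m + i)) (Suc j) * w (Suc j))"
        by (simp add: toeplitz_entry_def cong: if_cong sum.cong)
      also have "\<dots> = (\<Sum>j<Suc n. ?t (Suc (m + i)) j * w j)"
        by (subst sum.lessThan_Suc_shift) (simp add: w0)
      also have "\<dots> = coeff P (Suc (m + i)) - s * coeff ?P (Suc (m + i))"
        using tw[of "Suc (m + i)"] that by (simp add: lessThan_Suc_atMost)
      also have "\<dots> = 0" using pq pq0 by (simp add: coeff_eq_0)
      finally show ?thesis .
    qed
    ultimately have "toeplitz_det (fps_nth f) m n = 0"
      unfolding toeplitz_kernel_iff using that by (intro exI[of _ "\<lambda>j. w (Suc j)"]) auto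
    with D show False ..
  qed
  have wz: "w j = 0" for j
    using w0 w[of "j - 1"] pq pq0 by (cases "j = 0"; cases "j \<le> n") (auto simp: w_def coeff_eq_0)
  have "Q = Polynomial.smult s ?Q" using wz by (intro poly_eqI) (simp add: w_def)
  then have "s \<noteq> 0" using pq by auto
  moreover have "P = Polynomial.smult s ?P"
  proof (rule poly_eqI)
    fix i show "coeff P i = coeff (Polynomial.smult s ?P) i"
      using tw[of i] wz pq pq0 by (cases "i \<le> m + n") (auto simp: coeff_eq_0)
  qed
  ultimately show ?thesis by blast
qed

section \<open>Reduction of the bad event to one explicit numerator\<close>

lemma erdos_turan_ratio_smult:
  assumes "s \<noteq> 0"
  shows "erdos_turan_ratio (Polynomial.smult s P) = erdos_turan_ratio P"
proof -
  have "sqrt (cmod (coeff (Polynomial.smult s P) 0) * cmod (lead_coeff (Polynomial.smult s P)))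
          = cmod s * sqrt (cmod (coeff P 0) * cmod (lead_coeff P))"
    by (simp add: norm_mult real_sqrt_mult)
  with assms show ?thesis
    by (simp add: erdos_turan_ratio_def norm_mult flip: sum_distrib_left)
qed

text \<open>This removes the quantifier over numerators, which makes the event measurable. If the
  determinant vanishes, there is a numerator with zero constant term; otherwise all numerators are
  nonzero multiples of \<open>P0\<close> and share its ratio.\<close>

lemma ex_bad_pade_numerator_iff:
  fixes f :: "complex fps" and m n :: nat
  defines "P0 \<equiv> pade_num_poly (fps_nth f) m n"
  shows "(\<exists>P. pade_numerator f m n P \<and>
           (coeff P 0 * lead_coeff P = 0 \<or> ln (erdos_turan_ratio P) > B)) \<longleftrightarrow>
         toeplitz_det (fps_nth f) m n = 0 \<or> fps_nth f 0 = 0 \<or> ln (erdos_turan_ratio P0) > B"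
    (is "?bad \<longleftrightarrow> ?D = 0 \<or> ?a = 0 \<or> ?L")
proof (cases "?D = 0")
  case True
  then show ?thesis using pade_numerator_degenerate[of f m n] by auto
next
  case False
  have P0: "pade_numerator f m n P0"
    using pade_pair_pade_polys[OF False] by (auto simp: pade_numerator_def P0_def)
  have c0: "coeff P0 0 = ?a * ?D" by (simp add: P0_def coeff_pade_num_poly_0)
  \<comment> \<open>A zero leading coefficient means \<open>P0 = 0\<close>, which forces the
    constant term to vanish as well.\<close>
  have bad0: "coeff P0 0 * lead_coeff P0 = 0 \<longleftrightarrow> ?a = 0"
    using False c0 by (auto simp: leading_coeff_0_iff)
  show ?thesis
  proof
    assume ?bad
    then obtain P where P: "pade_numerator f m n P"
      "coeff P 0 * lead_coeff P = 0 \<or> ln (erdos_turan_ratio P) > B" by blast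
    obtain s where "s \<noteq> 0" "P = Polynomial.smult s P0"
      using pade_numerator_unique[OF False P(1)] by (auto simp: P0_def)
    then show "?D = 0 \<or> ?a = 0 \<or> ?L"
      using P(2) bad0 by (auto simp: erdos_turan_ratio_smult)
  next
    assume "?D = 0 \<or> ?a = 0 \<or> ?L"
    then show ?bad using P0 bad0 False by blast
  qed
qed

subsection \<open>Anti-concentration of Toeplitz determinants\<close>

lemma toeplitz_det_0: "toeplitz_det c 0 k = c 0 ^ k"
proof (induction k)
  case 0
  have "Determinant.det (toeplitz c 0 0) = 1" by (rule det_dim_zero) simp
  then show ?case by (simp add: toeplitz_det_def)
next
  case (Suc k)
  then show ?case
    \<comment> \<open>For m = 0 the constant and the top coefficient of the numerator are the same,
      which gives the recursion.\<close>
    using coeff_pade_num_poly_0[of c 0 k] coeff_pade_num_poly_top[of c 0 k] by simp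
qed

text \<open>In the Laplace expansion along the last row, the corner entry occurs in column 0 only
  and in none of the cofactors. The determinant is therefore affine in it, and its value at 0 is the
  constant term.\<close>

lemma toeplitz_det_expand_corner:
  assumes "m > 0"
  shows "toeplitz_det c m (Suc k)
    = (- 1) ^ k * toeplitz_det c (m - 1) k * c (m + k) + toeplitz_det (c(m + k := 0)) m (Suc k)"
proof -
  define d where "d = c(m + k := 0)"
  define q where "q = (\<lambda>j. cofactor (toeplitz c m (Suc k)) k j)"
  have "mat_delete (toeplitz d m (Suc k)) k j = mat_delete (toeplitz c m (Suc k)) k j" for j
    by (rule eq_matI) (auto simp: mat_delete_def toeplitz_def toeplitz_entry_def d_def)
  then have qd: "cofactor (toeplitz d m (Suc k)) k j = q j" for j
    by (simp add: q_def cofactor_def)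
  have "toeplitz_det c m (Suc k) = (\<Sum>j<Suc k. toeplitz_entry c (m + k) j * q j)"
    using laplace_expansion_row[of "toeplitz c m (Suc k)" "Suc k" k]
    by (simp add: toeplitz_det_def q_def)
  moreover have "toeplitz_det d m (Suc k) = (\<Sum>j<Suc k. toeplitz_entry d (m + k) j * q j)"
    using laplace_expansion_row[of "toeplitz d m (Suc k)" "Suc k" k]
    by (simp add: toeplitz_det_def qd)
  moreover have "(\<Sum>j<k. toeplitz_entry d (m + k) (Suc j) * q (Suc j))
                   = (\<Sum>j<k. toeplitz_entry c (m + k) (Suc j) * q (Suc j))"
    by (intro sum.cong) (auto simp: toeplitz_entry_def d_def)
  ultimately have "toeplitz_det c m (Suc k) - toeplitz_det d m (Suc k) = c (m + k) * q 0"
    by (simp only: sum.lessThan_Suc_shift) (simp add: toeplitz_entry_def d_def)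
  moreover have "q 0 = (- 1) ^ k * toeplitz_det c (m - 1) k"
    using mat_delete_toeplitz_corner[OF assms, of c k]
    by (simp add: q_def cofactor_def toeplitz_det_def)
  ultimately show ?thesis by (simp add: d_def algebra_simps)
qed

section \<open>Measurability of determinants and cofactors\<close>

lemma borel_measurable_det:
  fixes A :: "'a \<Rightarrow> complex Matrix.mat"
  assumes "\<And>x. A x \<in> carrier_mat k k"
    and [measurable]: "\<And>i j. i < k \<Longrightarrow> j < k \<Longrightarrow> (\<lambda>x. A x $$ (i, j)) \<in> borel_measurable M"
  shows "(\<lambda>x. Determinant.det (A x)) \<in> borel_measurable M"
proof -
  have "(\<lambda>x. \<Prod>i = 0..<k. A x $$ (i, p i)) \<in> borel_measurable M" if "p permutes {0..<k}" for p
  proof (intro borel_measurable_prod assms(2))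
    fix i assume "i \<in> {0..<k}"
    then show "i < k" "p i < k" using permutes_in_image[OF that, of i] by auto
  qed
  then show ?thesis
    by (subst det_def'[OF assms(1)]) (intro borel_measurable_sum borel_measurable_times; simp)
qed

lemma borel_measurable_toeplitz_entry:
  fixes c :: "'a \<Rightarrow> nat \<Rightarrow> complex"
  assumes "\<And>l. l \<le> i \<Longrightarrow> (\<lambda>x. c x l) \<in> borel_measurable M"
  shows "(\<lambda>x. toeplitz_entry (c x) i j) \<in> borel_measurable M"
  using assms by (cases "j \<le> i") (auto simp: toeplitz_entry_def)

lemma borel_measurable_toeplitz_det:
  fixes c :: "'a \<Rightarrow> nat \<Rightarrow> complex"
  assumes "\<And>l. l < m + k \<Longrightarrow> (\<lambda>x. c x l) \<in> borel_measurable M"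
  shows "(\<lambda>x. toeplitz_det (c x) m k) \<in> borel_measurable M"
  unfolding toeplitz_det_def
  using assms by (intro borel_measurable_det[where k = k]) (auto intro!: borel_measurable_toeplitz_entry)

lemma borel_measurable_toeplitz_cofactor:
  fixes c :: "'a \<Rightarrow> nat \<Rightarrow> complex"
  assumes "\<And>l. l \<le> m + n \<Longrightarrow> (\<lambda>x. c x l) \<in> borel_measurable M"
  shows "(\<lambda>x. toeplitz_cofactor (c x) m n j) \<in> borel_measurable M"
  unfolding toeplitz_cofactor_def cofactor_def
proof (intro borel_measurable_times borel_measurable_const borel_measurable_det[where k = n])
  show "mat_delete (toeplitz (c x) m (Suc n)) 0 j \<in> carrier_mat n n" for x
    using mat_delete_carrier[OF toeplitz_carrier, of "c x" m "Suc n"] by simp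
  show "(\<lambda>x. mat_delete (toeplitz (c x) m (Suc n)) 0 j $$ (i, l)) \<in> borel_measurable M"
    if "i < n" "l < n" for i l
    using that assms
    by (auto simp: mat_delete_def toeplitz_def intro!: borel_measurable_toeplitz_entry)
qed

section \<open>Small balls around fixed and random centres\<close>

lemma (in prob_space) prob_near_le_levy_concentration:
  assumes [measurable]: "X \<in> borel_measurable M"
  shows "prob {\<omega> \<in> space M. norm (X \<omega> - t) < \<delta>} \<le> levy_concentration M X \<delta>"
  unfolding levy_concentration_def
  by (rule cSUP_upper) (auto intro!: bdd_aboveI2[where M = 1])

text \<open>By independence the joint law is a product. Fubini then fixes the value of
  \<open>T\<close>, and each section is a small ball with a fixed centre.\<close>

lemma (in prob_space) prob_near_indep_le_levy_concentration:
  fixes X T :: "'a \<Rightarrow> 'b::{real_normed_vector, second_countable_topology}"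
  assumes ind: "indep_var borel X borel T"
  shows "prob {\<omega> \<in> space M. norm (X \<omega> - T \<omega>) < \<delta>} \<le> levy_concentration M X \<delta>"
proof -
  have [measurable]: "X \<in> borel_measurable M" "T \<in> borel_measurable M"
    using indep_var_rv1[OF ind] indep_var_rv2[OF ind] by auto
  interpret X: prob_space "distr M borel X" by (rule prob_space_distr) simp
  interpret T: prob_space "distr M borel T" by (rule prob_space_distr) simp
  interpret P: pair_prob_space "distr M borel X" "distr M borel T" ..
  let ?L = "levy_concentration M X \<delta>"
  define A where "A = {p :: 'b \<times> 'b. norm (fst p - snd p) < \<delta>}"
  have A [measurable]: "A \<in> sets (borel \<Otimes>\<^sub>M borel)"
    unfolding A_def borel_prod by (intro borel_open open_Collect_less continuous_intros)
  \<comment> \<open>Needed to transfer the final inequality from \<open>ennreal\<close> back to the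
    reals.\<close>
  have L0: "0 \<le> ?L"
    using prob_near_le_levy_concentration[of X 0 \<delta>] by (meson measure_nonneg order_trans \<open>X \<in> borel_measurable M\<close>)
  have "emeasure M {\<omega> \<in> space M. norm (X \<omega> - T \<omega>) < \<delta>}
          = emeasure (distr M (borel \<Otimes>\<^sub>M borel) (\<lambda>\<omega>. (X \<omega>, T \<omega>))) A"
    using A by (subst emeasure_distr)
      (auto simp: A_def vimage_def Int_def conj_commute intro!: arg_cong[where f = "emeasure M"])
  also have "\<dots> = emeasure (distr M borel X \<Otimes>\<^sub>M distr M borel T) A"
    using ind by (simp add: indep_var_distribution_eq)
  also have "\<dots> = (\<integral>\<^sup>+ y. emeasure (distr M borel X) ((\<lambda>x. (x, y)) -` A) \<partial>distr M borel T)"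
    by (rule P.emeasure_pair_measure_alt2) (simp add: A cong: sets_pair_measure_cong)
  also have "\<dots> \<le> (\<integral>\<^sup>+ y. ennreal ?L \<partial>distr M borel T)"
  proof (rule nn_integral_mono)
    fix y :: 'b
    have "{x. norm (x - y) < \<delta>} \<in> sets borel" by measurable
    then have "emeasure (distr M borel X) ((\<lambda>x. (x, y)) -` A)
            = emeasure M {\<omega> \<in> space M. norm (X \<omega> - y) < \<delta>}"
      by (subst emeasure_distr)
         (auto simp: A_def vimage_def Int_def conj_commute intro!: arg_cong[where f = "emeasure M"])
    also have "\<dots> \<le> ennreal ?L"
      by (simp add: emeasure_eq_measure prob_near_le_levy_concentration ennreal_leI)
    finally show "emeasure (distr M borel X) ((\<lambda>x. (x, y)) -` A) \<le> ennreal ?L" .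
  qed
  also have "\<dots> = ennreal ?L"
    using T.emeasure_space_1 by simp
  finally show ?thesis using L0 by (simp add: emeasure_eq_measure)
qed

text \<open>The induction keeps \<open>m\<close> arbitrary because the cofactor of the corner entry
  belongs to \<open>m - 1\<close>. The bound on \<open>m + k\<close> keeps the corner index m + k -
  1 within \<open>N\<close>.\<close>

lemma (in prob_space) prob_toeplitz_det_small_le:
  fixes a :: "nat \<Rightarrow> 'a \<Rightarrow> complex"
  assumes ind: "indep_vars (\<lambda>_. borel) a {0..N}"
    and levy: "\<And>j. j \<le> N \<Longrightarrow> levy_concentration M (a j) \<epsilon> \<le> b"
    and "0 < \<epsilon>" and "0 \<le> b"
    and "m + k \<le> Suc N"
  shows "prob {\<omega> \<in> space M. cmod (toeplitz_det (\<lambda>j. a j \<omega>) m k) < \<epsilon> ^ k} \<le> real k * b"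
  using \<open>m + k \<le> Suc N\<close>
proof (induction k arbitrary: m)
  case 0
  have "toeplitz_det c m 0 = 1" for c :: "nat \<Rightarrow> complex"
    unfolding toeplitz_det_def by (rule det_dim_zero) simp
  then show ?case by simp
next
  case (Suc k)
  have meas [measurable]: "a j \<in> borel_measurable M" if "j \<le> N" for j
    using ind that by (auto simp: indep_vars_def)
  show ?case
  proof (cases "m = 0")
    \<comment> \<open>Here the determinant is a power of a_0, so a single event of probability at
      most \<open>b\<close> suffices.\<close>
    case True
    have "cmod (a 0 \<omega>) < \<epsilon>" if "cmod (a 0 \<omega>) ^ Suc k < \<epsilon> ^ Suc k" for \<omega>
      using power_less_imp_less_base[OF that] \<open>0 < \<epsilon>\<close> by simp
    then have "prob {\<omega> \<in> space M. cmod (toeplitz_det (\<lambda>j. a j \<omega>) m (Suc k)) < \<epsilon> ^ Suc k}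
        \<le> prob {\<omega> \<in> space M. norm (a 0 \<omega> - 0) < \<epsilon>}"
      using True meas[of 0]
      by (intro finite_measure_mono) (auto simp: toeplitz_det_0 norm_power norm_mult simp del: power_Suc)
    also have "\<dots> \<le> b"
      using prob_near_le_levy_concentration[OF meas, of 0 0 \<epsilon>] levy[of 0] by simp
    also have "\<dots> \<le> real (Suc k) * b" using \<open>0 \<le> b\<close> by (simp add: algebra_simps)
    finally show ?thesis .
  next
    case False
    define J where "J = m + k"
    have J: "J \<le> N" using Suc.prems by (simp add: J_def)
    define D where "D = (\<lambda>x :: nat \<Rightarrow> complex. toeplitz_det x (m - 1) k)"
    define R where "R = (\<lambda>x :: nat \<Rightarrow> complex. toeplitz_det (x(J := 0)) m (Suc k))"
    \<comment> \<open>The value of a_J at which the determinant vanishes. Where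
      \<open>D x = 0\<close> division yields 0, which is harmless because such outcomes belong to
      \<open>?E1\<close>.\<close>
    define g where "g = (\<lambda>x. - R x / ((- 1) ^ k * D x))"
    \<comment> \<open>The centre uses only a_0, ..., a_(J-1) and is therefore independent of
      a_J.\<close>
    have g_restrict: "g (restrict x {..<J}) = g x" for x
    proof -
      have "D (restrict x {..<J}) = D x"
        unfolding D_def toeplitz_det_def using False
        by (intro arg_cong[where f = Determinant.det] toeplitz_cong) (auto simp: J_def)
      moreover have "R (restrict x {..<J}) = R x"
        unfolding R_def toeplitz_det_def
        by (intro arg_cong[where f = Determinant.det] toeplitz_cong) (auto simp: J_def)
      ultimately show ?thesis by (simp add: g_def)
    qed
    have "g \<in> borel_measurable (PiM {..<J} (\<lambda>_. borel))"
      unfolding g_def D_def R_def using False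
      by (intro borel_measurable_divide borel_measurable_times borel_measurable_uminus
            borel_measurable_const borel_measurable_toeplitz_det)
         (auto simp: J_def less_Suc_eq intro!: measurable_component_singleton)
    then have "indep_var borel ((\<lambda>x. x J) \<circ> (\<lambda>\<omega>. restrict (\<lambda>j. a j \<omega>) {J}))
                 borel (g \<circ> (\<lambda>\<omega>. restrict (\<lambda>j. a j \<omega>) {..<J}))"
      using J by (intro indep_var_compose[OF indep_var_restrict[OF ind]]) auto
    then have ind': "indep_var borel (a J) borel (\<lambda>\<omega>. g (\<lambda>j. a j \<omega>))"
      by (simp add: o_def g_restrict)
    have [measurable]: "a J \<in> borel_measurable M" "(\<lambda>\<omega>. g (\<lambda>j. a j \<omega>)) \<in> borel_measurable M"
      using indep_var_rv1[OF ind'] indep_var_rv2[OF ind'] by auto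
    have [measurable]: "(\<lambda>\<omega>. D (\<lambda>j. a j \<omega>)) \<in> borel_measurable M"
      unfolding D_def using J by (intro borel_measurable_toeplitz_det) (auto simp: J_def)
    let ?E1 = "{\<omega> \<in> space M. cmod (D (\<lambda>j. a j \<omega>)) < \<epsilon> ^ k}"
    let ?E2 = "{\<omega> \<in> space M. cmod (a J \<omega> - g (\<lambda>j. a j \<omega>)) < \<epsilon>}"
    have "prob {\<omega> \<in> space M. cmod (toeplitz_det (\<lambda>j. a j \<omega>) m (Suc k)) < \<epsilon> ^ Suc k} \<le> prob (?E1 \<union> ?E2)"
    proof (rule finite_measure_mono)
      show "{\<omega> \<in> space M. cmod (toeplitz_det (\<lambda>j. a j \<omega>) m (Suc k)) < \<epsilon> ^ Suc k} \<subseteq> ?E1 \<union> ?E2"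
      proof safe
        fix \<omega> assume small: "cmod (toeplitz_det (\<lambda>j. a j \<omega>) m (Suc k)) < \<epsilon> ^ Suc k"
          and big: "\<not> cmod (a J \<omega> - g (\<lambda>j. a j \<omega>)) < \<epsilon>" and "\<omega> \<in> space M"
        show "cmod (D (\<lambda>j. a j \<omega>)) < \<epsilon> ^ k"
        proof (rule ccontr)
          assume D: "\<not> cmod (D (\<lambda>j. a j \<omega>)) < \<epsilon> ^ k"
          with \<open>0 < \<epsilon>\<close> have D0: "D (\<lambda>j. a j \<omega>) \<noteq> 0" by auto
          have "toeplitz_det (\<lambda>j. a j \<omega>) m (Suc k)
                  = (- 1) ^ k * D (\<lambda>j. a j \<omega>) * a J \<omega> + R (\<lambda>j. a j \<omega>)"
            using toeplitz_det_expand_corner[of m "\<lambda>j. a j \<omega>" k] False by (simp add: D_def R_def J_def)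
          \<comment> \<open>Factored this way, a small determinant forces a small cofactor or an a_J
            close to the centre.\<close>
          also have "\<dots> = (- 1) ^ k * D (\<lambda>j. a j \<omega>) * (a J \<omega> - g (\<lambda>j. a j \<omega>))"
            using D0 by (simp add: g_def field_simps)
          finally have "cmod (toeplitz_det (\<lambda>j. a j \<omega>) m (Suc k))
                  = cmod (D (\<lambda>j. a j \<omega>)) * cmod (a J \<omega> - g (\<lambda>j. a j \<omega>))"
            by (simp add: norm_mult norm_power)
          also have "\<dots> \<ge> \<epsilon> ^ k * \<epsilon>"
            using D big \<open>0 < \<epsilon>\<close> by (intro mult_mono) auto
          finally show False using small by (simp add: mult.commute)
        qed
      qed
    qed measurable
    also have "\<dots> \<le> prob ?E1 + prob ?E2"
      by (rule measure_Un_le) measurable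
    also have "prob ?E1 \<le> real k * b"
      unfolding D_def using Suc.IH[of "m - 1"] Suc.prems by simp
    also have "prob ?E2 \<le> b"
      using prob_near_indep_le_levy_concentration[OF ind', of \<epsilon>] levy[OF J] by simp
    finally show ?thesis by (simp add: algebra_simps)
  qed
qed

subsection \<open>Upper bounds\<close>

text \<open>A permutation of {0..n} is determined by its values on {1..n}, so the left side is a
  subsum of the expansion of the right side over all maps {1..n} -> {0..n}; the extra terms are
  nonnegative.\<close>

lemma sum_prod_permutes_le:
  fixes g :: "nat \<Rightarrow> nat \<Rightarrow> real"
  assumes "\<And>i j. 0 \<le> g i j"
  shows "(\<Sum>p | p permutes {0..<Suc n}. \<Prod>i = 1..n. g i (p i)) \<le> (\<Prod>i = 1..n. \<Sum>j\<le>n. g i j)"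
proof -
  let ?S = "{p. p permutes {0..<Suc n}}" and ?r = "\<lambda>p :: nat \<Rightarrow> nat. restrict p {1..n}"
  have inj: "inj_on ?r ?S"
  proof (rule inj_onI, rule ext)
    fix p p' and x :: nat assume S: "p \<in> ?S" "p' \<in> ?S" and r: "?r p = ?r p'"
    have eq: "p i = p' i" if "i \<in> {1..n}" for i
      using fun_cong[OF r, of i] that by simp
    show "p x = p' x"
    proof (cases "x = 0")
      case True
      \<comment> \<open>The value \<open>p 0\<close> is attained by p', but not on {1..n}, where p'
        agrees with the injective \<open>p\<close>; it is thus p' at 0.\<close>
      have "p 0 \<in> p' ` {0..<Suc n}"
        using S permutes_image[of p' "{0..<Suc n}"] permutes_in_image[of p "{0..<Suc n}" 0] by simp
      then obtain i where i: "i < Suc n" "p 0 = p' i" by auto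
      have "i = 0"
      proof (rule ccontr)
        assume "i \<noteq> 0"
        then have "p 0 = p i" using i eq[of i] by simp
        then show False using S \<open>i \<noteq> 0\<close> permutes_inj[of p] by (auto dest: injD)
      qed
      with i True show ?thesis by simp
    next
      case False
      then show ?thesis using S eq[of x] by (cases "x \<le> n") (auto simp: permutes_def)
    qed
  qed
  have "(\<Sum>p\<in>?S. \<Prod>i = 1..n. g i (p i)) = (\<Sum>q\<in>?r ` ?S. \<Prod>i = 1..n. g i (q i))"
    using inj by (subst sum.reindex) auto
  also have "\<dots> \<le> (\<Sum>q\<in>PiE {1..n} (\<lambda>_. {..n}). \<Prod>i = 1..n. g i (q i))"
  proof (rule sum_mono2)
    show "?r ` ?S \<subseteq> PiE {1..n} (\<lambda>_. {..n})"
    proof (rule image_subsetI)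
      fix p assume "p \<in> ?S"
      then have "p i < Suc n" if "i < Suc n" for i
        using permutes_in_image[of p "{0..<Suc n}" i] that by simp
      then have "p i \<le> n" if "i \<le> n" for i
        using that by (simp flip: less_Suc_eq_le)
      then show "?r p \<in> PiE {1..n} (\<lambda>_. {..n})" by simp
    qed
  qed (auto intro!: finite_PiE prod_nonneg assms)
  also have "\<dots> = (\<Prod>i = 1..n. \<Sum>j\<le>n. g i j)"
    by (rule prod_sum_PiE[symmetric]) auto
  finally show ?thesis .
qed

text \<open>Replacing the first row by the conjugate phases of its cofactors turns the sum of their moduli
  into a single determinant, so that no factor \<open>n + 1\<close> is lost.\<close>

lemma sum_norm_cofactor_le:
  fixes A :: "complex Matrix.mat"
  assumes A: "A \<in> carrier_mat (Suc n) (Suc n)"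
  shows "(\<Sum>j\<le>n. cmod (cofactor A 0 j)) \<le> (\<Prod>i = 1..n. \<Sum>j\<le>n. cmod (A $$ (i, j)))"
proof -
  define u where "u = (\<lambda>j. cnj (sgn (cofactor A 0 j)))"
  \<comment> \<open>Only an inequality, since \<open>sgn 0 = 0\<close> at vanishing
    cofactors.\<close>
  have u: "cmod (u j) \<le> 1" for j by (simp add: u_def norm_sgn)
  have uc: "u j * cofactor A 0 j = of_real (cmod (cofactor A 0 j))" for j
    by (cases "cofactor A 0 j = 0")
       (auto simp: u_def sgn_eq field_simps complex_norm_square[symmetric] power2_eq_square)
  define B where "B = Matrix.mat (Suc n) (Suc n) (\<lambda>(i, j). if i = 0 then u j else A $$ (i, j))"
  have B: "B \<in> carrier_mat (Suc n) (Suc n)" by (simp add: B_def)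
  have B0: "B $$ (0, j) = u j" if "j < Suc n" for j using that by (simp add: B_def)
  have "mat_delete B 0 j = mat_delete A 0 j" for j
    using A by (intro eq_matI) (auto simp: mat_delete_def B_def)
  then have cof: "cofactor B 0 j = cofactor A 0 j" for j by (simp add: cofactor_def)
  have "Determinant.det B = (\<Sum>j<Suc n. B $$ (0, j) * cofactor B 0 j)"
    by (rule laplace_expansion_row[OF B]) simp
  also have "\<dots> = (\<Sum>j<Suc n. of_real (cmod (cofactor A 0 j)))"
    by (intro sum.cong) (auto simp: cof uc B0)
  also have "\<dots> = of_real (\<Sum>j\<le>n. cmod (cofactor A 0 j))"
    by (simp only: lessThan_Suc_atMost of_real_sum)
  finally have "(\<Sum>j\<le>n. cmod (cofactor A 0 j)) = cmod (Determinant.det B)"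
    by (simp only: norm_of_real) (simp add: sum_nonneg)
  also have "\<dots> \<le> (\<Sum>p | p permutes {0..<Suc n}. \<Prod>i = 0..<Suc n. cmod (B $$ (i, p i)))"
    unfolding det_def'[OF B]
    by (rule sum_norm_le) (auto simp: norm_mult sign_def prod_norm)
  also have "\<dots> \<le> (\<Sum>p | p permutes {0..<Suc n}. \<Prod>i = 1..n. cmod (A $$ (i, p i)))"
  proof (rule sum_mono)
    fix p assume "p \<in> {p. p permutes {0..<Suc n}}"
    then have p: "p i < Suc n" if "i < Suc n" for i
      using permutes_in_image[of p "{0..<Suc n}" i] that by simp
    have "(\<Prod>i = 0..<Suc n. cmod (B $$ (i, p i)))
            = cmod (u (p 0)) * (\<Prod>i = 1..n. cmod (B $$ (i, p i)))"
      using p[of 0] by (subst prod.atLeast_Suc_lessThan) (auto simp: B_def atLeastLessThanSuc_atLeastAtMost)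
    also have "(\<Prod>i = 1..n. cmod (B $$ (i, p i))) = (\<Prod>i = 1..n. cmod (A $$ (i, p i)))"
      using p by (intro prod.cong) (auto simp: B_def)
    also have "cmod (u (p 0)) * \<dots> \<le> \<dots>"
      using u[of "p 0"] by (intro mult_left_le_one_le prod_nonneg) auto
    finally show "(\<Prod>i = 0..<Suc n. cmod (B $$ (i, p i))) \<le> (\<Prod>i = 1..n. cmod (A $$ (i, p i)))" .
  qed
  also have "\<dots> \<le> (\<Prod>i = 1..n. \<Sum>j\<le>n. cmod (A $$ (i, j)))"
    by (rule sum_prod_permutes_le) simp
  finally show ?thesis .
qed

lemma sum_norm_comp_le:
  assumes "inj_on h A" "h ` A \<subseteq> L" "finite L"
  shows "(\<Sum>x\<in>A. norm (c (h x))) \<le> (\<Sum>l\<in>L. norm (c l))"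
proof -
  have "(\<Sum>x\<in>A. norm (c (h x))) = (\<Sum>l\<in>h ` A. norm (c l))"
    using assms(1) by (simp add: sum.reindex)
  also have "\<dots> \<le> (\<Sum>l\<in>L. norm (c l))"
    using assms by (intro sum_mono2) auto
  finally show ?thesis .
qed

text \<open>Only rows 1 to n enter the cofactors. Their indices m + i - j lie between m + 1 - n and
  m + n, and within a row each index occurs at most once, so every row sum is at most
  \<open>?S\<close>.\<close>

lemma sum_norm_toeplitz_cofactor_le:
  fixes c :: "nat \<Rightarrow> complex"
  shows "(\<Sum>j\<le>n. cmod (toeplitz_cofactor c m n j)) \<le> (\<Sum>l = m + 1 - n..m + n. cmod (c l)) ^ n"
proof -
  let ?S = "\<Sum>l = m + 1 - n..m + n. cmod (c l)"
  have "(\<Sum>j\<le>n. cmod (toeplitz_cofactor c m n j))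
      \<le> (\<Prod>i = 1..n. \<Sum>j\<le>n. cmod (toeplitz c m (Suc n) $$ (i, j)))"
    unfolding toeplitz_cofactor_def by (rule sum_norm_cofactor_le) simp
  also have "\<dots> \<le> (\<Prod>i = 1..n. ?S)"
  proof (intro prod_mono conjI sum_nonneg)
    fix i assume i: "i \<in> {1..n}"
    have "(\<Sum>j\<le>n. cmod (toeplitz c m (Suc n) $$ (i, j))) = (\<Sum>j\<in>{..n} \<inter> {..m + i}. cmod (c (m + i - j)))"
      using i by (intro sum.mono_neutral_cong_right) (auto simp: toeplitz_entry_def)
    also have "\<dots> \<le> ?S"
      using i by (intro sum_norm_comp_le) (auto simp: inj_on_def)
    finally show "(\<Sum>j\<le>n. cmod (toeplitz c m (Suc n) $$ (i, j))) \<le> ?S" .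
  qed auto
  finally show ?thesis by simp
qed

text \<open>The l1 norm is submultiplicative under convolution; coefficients of f Q up to degree m
  involve only \<open>c 0\<close>, ..., \<open>c m\<close> from f.\<close>

lemma sum_norm_pade_num_poly_le:
  fixes c :: "nat \<Rightarrow> complex"
  shows "(\<Sum>i\<le>m. cmod (coeff (pade_num_poly c m n) i))
    \<le> (\<Sum>i\<le>m. cmod (c i)) * (\<Sum>l = m + 1 - n..m + n. cmod (c l)) ^ n"
proof -
  let ?q = "toeplitz_cofactor c m n"
  have "(\<Sum>i\<le>m. cmod (coeff (pade_num_poly c m n) i))
      \<le> (\<Sum>i\<le>m. \<Sum>j\<le>n. cmod (toeplitz_entry c i j) * cmod (?q j))"
    by (intro sum_mono) (auto simp: coeff_pade_num_poly norm_mult intro!: sum_norm_le)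
  also have "\<dots> = (\<Sum>j\<le>n. (\<Sum>i\<le>m. cmod (toeplitz_entry c i j)) * cmod (?q j))"
    by (subst sum.swap) (simp add: sum_distrib_right)
  also have "\<dots> \<le> (\<Sum>j\<le>n. (\<Sum>i\<le>m. cmod (c i)) * cmod (?q j))"
  proof (rule sum_mono, rule mult_right_mono)
    fix j
    have "(\<Sum>i\<le>m. cmod (toeplitz_entry c i j)) = (\<Sum>i\<in>{j..m}. cmod (c (i - j)))"
      by (intro sum.mono_neutral_cong_right) (auto simp: toeplitz_entry_def)
    also have "\<dots> \<le> (\<Sum>i\<le>m. cmod (c i))"
      by (intro sum_norm_comp_le) (auto simp: inj_on_def)
    finally show "(\<Sum>i\<le>m. cmod (toeplitz_entry c i j)) \<le> (\<Sum>i\<le>m. cmod (c i))" .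
  qed auto
  also have "\<dots> = (\<Sum>i\<le>m. cmod (c i)) * (\<Sum>j\<le>n. cmod (?q j))"
    by (simp add: sum_distrib_left)
  also have "\<dots> \<le> (\<Sum>i\<le>m. cmod (c i)) * (\<Sum>l = m + 1 - n..m + n. cmod (c l)) ^ n"
    by (intro mult_left_mono sum_norm_toeplitz_cofactor_le sum_nonneg) simp
  finally show ?thesis .
qed

lemma erdos_turan_ratio_pade_num_poly:
  fixes c :: "nat \<Rightarrow> complex"
  assumes "0 < \<epsilon>" and c0: "\<epsilon> \<le> cmod (c 0)"
    and D: "\<epsilon> ^ n \<le> cmod (toeplitz_det c m n)" "\<epsilon> ^ Suc n \<le> cmod (toeplitz_det c m (Suc n))"
  shows "0 < erdos_turan_ratio (pade_num_poly c m n)"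
    and "erdos_turan_ratio (pade_num_poly c m n)
      \<le> (\<Sum>i\<le>m. cmod (c i)) * (\<Sum>l = m + 1 - n..m + n. cmod (c l)) ^ n / \<epsilon> ^ Suc n"
proof -
  let ?P = "pade_num_poly c m n"
  have "0 < \<epsilon> ^ Suc n" using \<open>0 < \<epsilon>\<close> by simp
  have top: "\<epsilon> ^ Suc n \<le> cmod (coeff ?P m)" using D by (simp add: coeff_pade_num_poly_top)
  then have "coeff ?P m \<noteq> 0" using \<open>0 < \<epsilon> ^ Suc n\<close> by auto
  \<comment> \<open>So the leading coefficient in the ratio is \<open>det A_m^(n+1)\<close>. Both
    extreme coefficients have modulus at least \<open>\<epsilon> ^ Suc n\<close>, hence so has their
    geometric mean.\<close>
  then have deg: "degree ?P = m" using degree_pade_num_poly[of c m n] le_degree[of ?P m] by simp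
  have bot: "\<epsilon> ^ Suc n \<le> cmod (coeff ?P 0)"
    unfolding coeff_pade_num_poly_0 norm_mult power_Suc
    using c0 D \<open>0 < \<epsilon>\<close> by (intro mult_mono) auto
  have "\<epsilon> ^ Suc n = sqrt (\<epsilon> ^ Suc n * \<epsilon> ^ Suc n)"
    using \<open>0 < \<epsilon> ^ Suc n\<close> by (simp only: real_sqrt_abs2 abs_of_pos)
  also have "\<dots> \<le> sqrt (cmod (coeff ?P 0) * cmod (coeff ?P m))"
    using top bot \<open>0 < \<epsilon> ^ Suc n\<close> by (intro real_sqrt_le_mono mult_mono) auto
  finally have den: "\<epsilon> ^ Suc n \<le> sqrt (cmod (coeff ?P 0) * cmod (coeff ?P m))" .
  have "0 < cmod (coeff ?P 0)" using bot \<open>0 < \<epsilon> ^ Suc n\<close> by linarith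
  also have "\<dots> \<le> (\<Sum>i\<le>m. cmod (coeff ?P i))" by (rule member_le_sum) auto
  finally have num: "0 < (\<Sum>i\<le>m. cmod (coeff ?P i))" .
  show "0 < erdos_turan_ratio ?P"
    unfolding erdos_turan_ratio_def deg
    using num den \<open>0 < \<epsilon> ^ Suc n\<close> by (intro divide_pos_pos) linarith+
  show "erdos_turan_ratio ?P
      \<le> (\<Sum>i\<le>m. cmod (c i)) * (\<Sum>l = m + 1 - n..m + n. cmod (c l)) ^ n / \<epsilon> ^ Suc n"
    unfolding erdos_turan_ratio_def deg
    using num den \<open>0 < \<epsilon> ^ Suc n\<close> sum_norm_pade_num_poly_le[of c m n]
    by (intro frac_le) linarith+
qed

text \<open>One factor n is at most 20^(n-1); its factors 20 are distributed over the other n - 1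
  factors n.\<close>

lemma power_self_le_power:
  fixes K :: real
  assumes "n \<ge> 1" "20 * real n \<le> K"
  shows "real n ^ n \<le> K ^ (n - 1)"
proof -
  have "real n \<le> 20 ^ (n - 1)"
  proof -
    have "n - 1 < 2 ^ (n - 1)" by (rule less_exp)
    then have "real n \<le> 2 ^ (n - 1)"
      using assms(1) by (metis Suc_leI Suc_pred' less_eq_Suc_le One_nat_def of_nat_le_iff of_nat_numeral of_nat_power)
    also have "\<dots> \<le> 20 ^ (n - 1)" by (intro power_mono) auto
    finally show ?thesis .
  qed
  have "real n ^ n = real n * real n ^ (n - 1)"
    using assms(1) by (cases n) auto
  also have "\<dots> \<le> 20 ^ (n - 1) * real n ^ (n - 1)"
    using \<open>real n \<le> 20 ^ (n - 1)\<close> by (intro mult_right_mono) auto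
  also have "\<dots> = (20 * real n) ^ (n - 1)" by (simp add: power_mult_distrib)
  also have "\<dots> \<le> K ^ (n - 1)" using assms by (intro power_mono) auto
  finally show ?thesis .
qed

text \<open>With K = 4\<gamma>/b, the assumption 5nb < 1 gives K \<ge> 20n, so n^n \<le> K^(n-1) and
  the exponents n - 1 and n + 1 add up to 2n. Since n + 1 \<le> 2n and \<epsilon> < 1, the
  denominator may be lowered to the same exponent.\<close>

lemma pade_ratio_numeric_bound:
  fixes m n :: nat and \<gamma> \<epsilon> b X S :: real
  assumes "n \<ge> 1" "1 \<le> \<gamma>" "0 < \<epsilon>" "\<epsilon> < 1" "0 < b" "5 * real n * b < 1"
    and X: "X \<le> 4 * real m * \<gamma> / b" and S: "0 \<le> S" "S \<le> 4 * real n * \<gamma> / b"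
  shows "X * S ^ n / \<epsilon> ^ Suc n \<le> real m * (4 * \<gamma> / (b * \<epsilon>)) ^ (2 * n)"
proof -
  define K where "K = 4 * \<gamma> / b"
  have "20 * real n * b \<le> 4 * \<gamma>" using assms by linarith
  then have K: "20 * real n \<le> K" using \<open>0 < b\<close> by (simp add: K_def field_simps)
  have K0: "0 < K" using assms by (simp add: K_def)
  have "X \<le> real m * K" "S \<le> real n * K" using X S by (simp_all add: K_def mult_ac)
  then have "X * S ^ n \<le> (real m * K) * (real n * K) ^ n"
    using S(1) K0 by (intro mult_mono power_mono) auto
  also have "\<dots> = real m * (real n ^ n * K ^ Suc n)"
    by (simp add: power_mult_distrib mult_ac)
  also have "\<dots> \<le> real m * (K ^ (n - 1) * K ^ Suc n)"
    using power_self_le_power[OF \<open>n \<ge> 1\<close> K] K0 by (intro mult_left_mono mult_right_mono) auto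
  also have "K ^ (n - 1) * K ^ Suc n = K ^ (2 * n)"
  proof -
    have "n - 1 + Suc n = 2 * n" using \<open>n \<ge> 1\<close> by simp
    then show ?thesis by (simp only: power_add[symmetric])
  qed
  finally have "X * S ^ n / \<epsilon> ^ Suc n \<le> real m * K ^ (2 * n) / \<epsilon> ^ Suc n"
    using \<open>0 < \<epsilon>\<close> by (intro divide_right_mono) auto
  also have "\<dots> \<le> real m * K ^ (2 * n) / \<epsilon> ^ (2 * n)"
    using assms K0 by (intro divide_left_mono power_decreasing) auto
  also have "\<dots> = real m * (4 * \<gamma> / (b * \<epsilon>)) ^ (2 * n)"
    by (simp add: K_def power_divide power_mult_distrib)
  finally show ?thesis .
qed

section \<open>Markov bound for coefficient sums and measurability of the ratio\<close>

lemma (in prob_space) prob_sum_norm_ge_le: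
  fixes a :: "nat \<Rightarrow> 'a \<Rightarrow> complex"
  assumes int: "\<And>j. j \<in> A \<Longrightarrow> integrable M (a j)"
    and le: "\<And>j. j \<in> A \<Longrightarrow> expectation (\<lambda>\<omega>. cmod (a j \<omega>)) \<le> \<gamma>"
    and "0 < t"
  shows "prob {\<omega> \<in> space M. t \<le> (\<Sum>j\<in>A. cmod (a j \<omega>))} \<le> real (card A) * \<gamma> / t"
proof -
  have "prob {\<omega> \<in> space M. t \<le> (\<Sum>j\<in>A. cmod (a j \<omega>))} \<le> expectation (\<lambda>\<omega>. \<Sum>j\<in>A. cmod (a j \<omega>)) / t"
    using int \<open>0 < t\<close>
    by (intro integral_Markov_inequality_measure[where A = "{}"]) (auto intro!: sum_nonneg)
  also have "expectation (\<lambda>\<omega>. \<Sum>j\<in>A. cmod (a j \<omega>)) = (\<Sum>j\<in>A. expectation (\<lambda>\<omega>. cmod (a j \<omega>)))"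
    using int by (intro Bochner_Integration.integral_sum) auto
  also have "\<dots> \<le> real (card A) * \<gamma>"
    using le by (intro sum_bounded_above)
  finally show ?thesis using \<open>0 < t\<close> by (simp add: divide_right_mono)
qed

lemma borel_measurable_erdos_turan_ratio:
  fixes P :: "'a \<Rightarrow> complex poly"
  assumes [measurable]: "\<And>i. (\<lambda>\<omega>. coeff (P \<omega>) i) \<in> borel_measurable M"
  shows "(\<lambda>\<omega>. erdos_turan_ratio (P \<omega>)) \<in> borel_measurable M"
proof -
  \<comment> \<open>The degree varies with the outcome but takes countably many values, and for each
    fixed degree the ratio is a measurable expression.\<close>
  have "(\<lambda>\<omega>. degree (P \<omega>)) \<in> measurable M (count_space UNIV)"
    unfolding degree_def by measurable
  then show ?thesis
    unfolding erdos_turan_ratio_def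
    by (rule measurable_compose_countable[rotated]) measurable
qed

subsection \<open>The probability estimate\<close>

text \<open>The event \<open>bad\<close> ranges over all numerators and also contains the outcomes
  where some numerator has no defined ratio, so the estimate holds whichever numerator is
  chosen.\<close>

theorem theorem3p1:
  fixes M :: "'w measure" and a :: "nat \<Rightarrow> 'w \<Rightarrow> complex"
    and m n N :: nat and \<gamma> \<epsilon> b :: real
    and f :: "'w \<Rightarrow> complex fps" and bad :: "'w set"
  assumes "m \<ge> 1" and "n \<ge> 1"
    and "1 \<le> \<gamma>"
    and "0 < \<epsilon>" and "\<epsilon> < 1"
    and "0 < b" and "b < 1"
    and "N \<ge> m + n"
    and "prob_space M"
    and "prob_space.indep_vars M (\<lambda>_. borel) a {0..N}"
    and "\<And>j. j \<le> N \<Longrightarrow> integrable M (a j)"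
    and "\<And>j. j \<le> N \<Longrightarrow> prob_space.expectation M (\<lambda>\<omega>. cmod (a j \<omega>)) \<le> \<gamma>"
    and "\<And>j. j \<le> N \<Longrightarrow> levy_concentration M (a j) \<epsilon> \<le> b"
    and f: "\<And>\<omega>. f \<omega> = (\<Sum>j=0..N. fps_const (a j \<omega>) * fps_X ^ j)"
    and bad: "bad = {\<omega> \<in> space M. \<exists>P. pade_numerator (f \<omega>) m n P \<and>
           (coeff P 0 * lead_coeff P = 0 \<or>
            ln (erdos_turan_ratio P) > ln (real m) + 2 * real n * ln (4 * \<gamma> / (b * \<epsilon>)))}"
  shows "bad \<in> sets M \<and> measure M bad \<le> 5 * real n * b"
proof -
  interpret prob_space M by fact
  let ?c = "\<lambda>\<omega>. fps_nth (f \<omega>)" and ?B = "ln (real m) + 2 * real n * ln (4 * \<gamma> / (b * \<epsilon>))"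
  have meas [measurable]: "a j \<in> borel_measurable M" if "j \<le> N" for j
    using \<open>indep_vars (\<lambda>_. borel) a {0..N}\<close> that by (auto simp: indep_vars_def)
  have c: "?c \<omega> j = (if j \<le> N then a j \<omega> else 0)" for \<omega> j
    by (simp add: f fps_sum_nth if_distrib[of "(*) _"] cong: if_cong)
  have c_meas [measurable]: "(\<lambda>\<omega>. ?c \<omega> j) \<in> borel_measurable M" for j
    by (cases "j \<le> N") (auto simp: c)
  \<comment> \<open>For these sizes the indices stay at most m + n \<le> N, so the truncation of the
    series at \<open>N\<close> is invisible.\<close>
  have det_c: "toeplitz_det (?c \<omega>) m k = toeplitz_det (\<lambda>j. a j \<omega>) m k" if "k \<le> Suc n" for \<omega> k
    unfolding toeplitz_det_def using that \<open>N \<ge> m + n\<close>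
    by (intro arg_cong[where f = Determinant.det] toeplitz_cong) (auto simp: c)
  have det_meas [measurable]: "(\<lambda>\<omega>. toeplitz_det (?c \<omega>) m k) \<in> borel_measurable M" for k
    by (intro borel_measurable_toeplitz_det c_meas)
  have "(\<lambda>\<omega>. coeff (pade_num_poly (?c \<omega>) m n) i) \<in> borel_measurable M" for i
    unfolding coeff_pade_num_poly
    by (cases "i \<le> m")
       (auto intro!: borel_measurable_sum borel_measurable_times borel_measurable_toeplitz_entry
          borel_measurable_toeplitz_cofactor)
  then have [measurable]: "(\<lambda>\<omega>. erdos_turan_ratio (pade_num_poly (?c \<omega>) m n)) \<in> borel_measurable M"
    by (rule borel_measurable_erdos_turan_ratio)
  have bad_eq: "bad = {\<omega> \<in> space M. toeplitz_det (?c \<omega>) m n = 0 \<or> ?c \<omega> 0 = 0 \<or>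
                       ln (erdos_turan_ratio (pade_num_poly (?c \<omega>) m n)) > ?B}"
    unfolding bad ex_bad_pade_numerator_iff ..
  have sets: "bad \<in> sets M" unfolding bad_eq by measurable
  moreover have "prob bad \<le> 5 * real n * b"
  proof (cases "5 * real n * b < 1")
    case False
    then show ?thesis using prob_le_1[of bad] by linarith
  next
    case True
    \<comment> \<open>The exceptional events \<open>E0\<close>, \<open>D n\<close>,
      \<open>D (Suc n)\<close>, \<open>X\<close> and \<open>S\<close> cost b, nb, (n+1)b, b/2 and
      b/2.\<close>
    define E0 where "E0 = {\<omega> \<in> space M. cmod (a 0 \<omega> - 0) < \<epsilon>}"
    define D where "D = (\<lambda>k. {\<omega> \<in> space M. cmod (toeplitz_det (\<lambda>j. a j \<omega>) m k) < \<epsilon> ^ k})"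
    \<comment> \<open>The thresholds of \<open>X\<close> and \<open>S\<close> are chosen so that
      Markov's inequality gives b/2: the sums have m + 1 \<le> 2m and at most 2n terms.\<close>
    define X where "X = {\<omega> \<in> space M. 4 * real m * \<gamma> / b \<le> (\<Sum>j\<in>{..m}. cmod (a j \<omega>))}"
    define S where "S = {\<omega> \<in> space M. 4 * real n * \<gamma> / b \<le> (\<Sum>j\<in>{m + 1 - n..m + n}. cmod (a j \<omega>))}"
    have D_meas [measurable]: "D k \<in> sets M" if "k \<le> Suc n" for k
    proof -
      have "D k = {\<omega> \<in> space M. cmod (toeplitz_det (?c \<omega>) m k) < \<epsilon> ^ k}"
        unfolding D_def det_c[OF that] ..
      then show ?thesis by simp
    qed
    have [measurable]: "E0 \<in> sets M" "X \<in> sets M" "S \<in> sets M"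
      unfolding E0_def X_def S_def using \<open>N \<ge> m + n\<close>
      by (auto intro!: borel_measurable_sum borel_measurable_le borel_measurable_norm measurable_compose[OF meas])
    have "bad \<subseteq> E0 \<union> (D n \<union> (D (Suc n) \<union> (X \<union> S)))"
    proof (rule ccontr)
      assume "\<not> ?thesis"
      then obtain \<omega> where \<omega>: "\<omega> \<in> bad" "\<omega> \<in> space M" "\<omega> \<notin> E0" "\<omega> \<notin> D n" "\<omega> \<notin> D (Suc n)"
        "\<omega> \<notin> X" "\<omega> \<notin> S" unfolding bad by blast
      let ?L = "erdos_turan_ratio (pade_num_poly (?c \<omega>) m n)"
      have c0: "\<epsilon> \<le> cmod (?c \<omega> 0)" using \<omega> by (simp add: E0_def c)
      have Dn: "\<epsilon> ^ n \<le> cmod (toeplitz_det (?c \<omega>) m n)"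
        "\<epsilon> ^ Suc n \<le> cmod (toeplitz_det (?c \<omega>) m (Suc n))"
        using \<omega> by (simp_all add: D_def det_c not_less)
      have Xc: "(\<Sum>j\<le>m. cmod (?c \<omega> j)) \<le> 4 * real m * \<gamma> / b"
        using \<omega> \<open>N \<ge> m + n\<close> by (simp add: X_def c)
      have Sc: "(\<Sum>j = m + 1 - n..m + n. cmod (?c \<omega> j)) \<le> 4 * real n * \<gamma> / b"
        using \<omega> \<open>N \<ge> m + n\<close> by (simp add: S_def c)
      note ratio = erdos_turan_ratio_pade_num_poly[OF \<open>0 < \<epsilon>\<close> c0 Dn]
      have K: "0 < 4 * \<gamma> / (b * \<epsilon>)"
        using \<open>1 \<le> \<gamma>\<close> \<open>0 < b\<close> \<open>0 < \<epsilon>\<close> by simp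
      have ln_power_bound: "ln (real m * x ^ (2 * n)) = ln (real m) + 2 * real n * ln x" if "0 < x" for x :: real
        using \<open>m \<ge> 1\<close> that by (simp add: ln_mult ln_realpow)
      have "?L \<le> real m * (4 * \<gamma> / (b * \<epsilon>)) ^ (2 * n)"
        using \<open>n \<ge> 1\<close> \<open>1 \<le> \<gamma>\<close> \<open>0 < \<epsilon>\<close> \<open>\<epsilon> < 1\<close> \<open>0 < b\<close> True Xc Sc
        by (intro order_trans[OF ratio(2)] pade_ratio_numeric_bound) (auto intro: sum_nonneg)
      then have "ln ?L \<le> ln (real m * (4 * \<gamma> / (b * \<epsilon>)) ^ (2 * n))"
        using ratio(1) by (simp add: ln_mono)
      also have "\<dots> = ?B"
        using ln_power_bound[OF K] .
      finally have "ln ?L \<le> ?B" .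
      \<comment> \<open>This excludes the two degenerate alternatives in
        \<open>bad_eq\<close>.\<close>
      moreover have "0 < cmod (toeplitz_det (?c \<omega>) m n)" "0 < cmod (?c \<omega> 0)"
        using c0 Dn(1) \<open>0 < \<epsilon>\<close> zero_less_power[OF \<open>0 < \<epsilon>\<close>, of n] by linarith+
      ultimately show False using \<omega>(1) by (simp add: bad_eq)
    qed
    then have "prob bad \<le> prob (E0 \<union> (D n \<union> (D (Suc n) \<union> (X \<union> S))))"
      by (intro finite_measure_mono) auto
    also have "\<dots> \<le> prob E0 + (prob (D n) + (prob (D (Suc n)) + (prob X + prob S)))"
      by (intro order_trans[OF measure_Un_le] add_left_mono) auto
    also have "prob E0 \<le> b"
      using prob_near_le_levy_concentration[OF meas, of 0 0 \<epsilon>] assms(13)[of 0]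
      by (simp add: E0_def)
    also have "prob (D n) \<le> real n * b"
      unfolding D_def using assms by (intro prob_toeplitz_det_small_le) auto
    also have "prob (D (Suc n)) \<le> real (Suc n) * b"
      unfolding D_def using assms by (intro prob_toeplitz_det_small_le) auto
    also have "prob X \<le> b / 2"
    proof -
      have "prob X \<le> real (card {..m}) * \<gamma> / (4 * real m * \<gamma> / b)"
        unfolding X_def using assms by (intro prob_sum_norm_ge_le) auto
      also have "\<dots> = (real m + 1) / (2 * real m) * (b / 2)"
        using \<open>m \<ge> 1\<close> \<open>1 \<le> \<gamma>\<close> \<open>0 < b\<close> by (simp add: divide_simps)
      also have "\<dots> \<le> 1 * (b / 2)"
        using \<open>m \<ge> 1\<close> \<open>0 < b\<close> by (intro mult_right_mono) (auto simp: field_simps)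
      finally show ?thesis by simp
    qed
    also have "prob S \<le> b / 2"
    proof -
      have "prob S \<le> real (card {m + 1 - n..m + n}) * \<gamma> / (4 * real n * \<gamma> / b)"
        unfolding S_def using assms by (intro prob_sum_norm_ge_le) auto
      \<comment> \<open>The interval has exactly 2n elements unless n > m + 1, when truncation at 0
        makes it shorter.\<close>
      also have "\<dots> \<le> real (2 * n) * \<gamma> / (4 * real n * \<gamma> / b)"
        using \<open>1 \<le> \<gamma>\<close> \<open>0 < b\<close> by (intro divide_right_mono mult_right_mono) auto
      also have "\<dots> = b / 2"
        using \<open>n \<ge> 1\<close> \<open>1 \<le> \<gamma>\<close> \<open>0 < b\<close> by (simp add: field_simps)
      finally show ?thesis .
    qed
    finally have "prob bad \<le> b * (2 * real n + 3)" by (simp add: algebra_simps)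
    \<comment> \<open>2n + 3 \<le> 5n because n \<ge> 1.\<close>
    also have "\<dots> \<le> b * (5 * real n)"
      using \<open>0 < b\<close> \<open>n \<ge> 1\<close> by (intro mult_left_mono) auto
    finally show ?thesis by (simp add: mult_ac)
  qed
  ultimately show ?thesis by blast
qed

end
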